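(* Let $F$ be a field of characteristic zero, let $E$ be an $n$-dimensional evolution algebra over $F$ with structural matrix $A=(a_{i,j})$, and suppose that $\dim M(E)=n$ and $\operatorname{rank}A=n$. Then the associative enveloping algebra $M(E)$ is isomorphic to the $n$-dimensional $F$-algebra $M_1$ with basis $x_1,\dots,x_n$ and multiplication $$x_ix_i=x_i,\qquad 1\le i\le n,$$ all other products of basis elements being zero.
   Context: An $n$-dimensional evolution algebra $E$ over $F$ is an algebra with a basis $\{e_1,\dots,e_n\}$ (the evolution basis) such that $e_i\cdot e_j=0$ for $i\ne j$ and $e_i\cdot e_i=\sum_{k=1}^n a_{i,k}e_k$; $A=(a_{i,k})$ is its matrix of structural constants. For $x\in E$, $R_x:E\to E$ is the right multiplication $R_x(y)=yx$. The associative enveloping algebra $M(E)$ is the (not necessarily unital) associative algebra of linear operators generated by $\{R_x: x\in E\}$, equivalently by $R_{e_1},\dots,R_{e_n}$. Operators are identified with matrices by $R_{e_i}=\sum_{k=1}^n a_{i,k}e_{i,k}$, where $e_{i,k}$ are matrix units, and multiplied as matrices, so that $R_{e_i}R_{e_j}=a_{i,j}\sum_{k=1}^n a_{j,k}e_{i,k}$. *)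

theory Defs
  imports "HOL-Analysis.Analysis" "HOL-Library.Function_Algebras"
begin

section \<open>Algebras with a distinguished finite basis\<close>

text \<open>Algebras are neither assumed associative nor unital: a vector space with a bilinear product.\<close>

locale nonassoc_algebra = vector_space smul
  for smul :: "'f::field \<Rightarrow> 'e::ab_group_add \<Rightarrow> 'e" +
  fixes mul :: "'e \<Rightarrow> 'e \<Rightarrow> 'e"
  assumes linear_mult_left: "Vector_Spaces.linear smul smul (\<lambda>x. mul x y)"
    and linear_mult_right: "Vector_Spaces.linear smul smul (\<lambda>y. mul x y)"

text \<open>The basis is indexed by a finite type, so the dimension of the algebra is \<open>CARD('n)\<close>.\<close>

locale algebra_with_basis = nonassoc_algebra smul mul
  for smul :: "'f::field \<Rightarrow> 'e::ab_group_add \<Rightarrow> 'e"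
    and mul :: "'e \<Rightarrow> 'e \<Rightarrow> 'e" +
  fixes e :: "'n::finite \<Rightarrow> 'e"
  assumes inj_basis: "inj e"
    and independent_basis: "\<not> module.dependent smul (range e)"
    and span_basis: "module.span smul (range e) = UNIV"

locale evolution_algebra = algebra_with_basis smul mul e
  for smul :: "'f::field \<Rightarrow> 'e::ab_group_add \<Rightarrow> 'e"
    and mul :: "'e \<Rightarrow> 'e \<Rightarrow> 'e"
    and e :: "'n::finite \<Rightarrow> 'e" +
  fixes A :: "'f^'n^'n"
  assumes mult_distinct: "i \<noteq> j \<Longrightarrow> mul (e i) (e j) = 0"
    and mult_same: "mul (e i) (e i) = (\<Sum>k\<in>UNIV. smul (A $ i $ k) (e k))"

locale algebra_M1 = algebra_with_basis smul mul x
  for smul :: "'f::field \<Rightarrow> 'e::ab_group_add \<Rightarrow> 'e"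
    and mul :: "'e \<Rightarrow> 'e \<Rightarrow> 'e"
    and x :: "'n::finite \<Rightarrow> 'e" +
  assumes M1_same: "mul (x i) (x i) = x i"
    and M1_distinct: "i \<noteq> j \<Longrightarrow> mul (x i) (x j) = 0"

section \<open>The associative enveloping algebra\<close>

definition right_mult :: "('e \<Rightarrow> 'e \<Rightarrow> 'e) \<Rightarrow> 'e \<Rightarrow> 'e \<Rightarrow> 'e" where
  "right_mult mul x = (\<lambda>y. mul y x)"

text \<open>Operators form a vector space under pointwise addition and scaling; addition is \<open>+\<close> on
  functions from \<open>Function_Algebras\<close> (whose pointwise \<open>*\<close> is not used).\<close>

definition op_scale :: "('f \<Rightarrow> 'e \<Rightarrow> 'e) \<Rightarrow> 'f \<Rightarrow> ('e \<Rightarrow> 'e) \<Rightarrow> ('e \<Rightarrow> 'e)" where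
  "op_scale smul c f = (\<lambda>y. smul c (f y))"

text \<open>The product of operators is composition with the left factor applied first (operators act
  on the right).  An operator is identified with the matrix whose \<open>i\<close>-th row holds the coordinates
  of the image of \<open>e i\<close>, and with this convention the product is the matrix product;
  see \<open>right_mult_product\<close> below.\<close>

definition op_mult :: "('e \<Rightarrow> 'e) \<Rightarrow> ('e \<Rightarrow> 'e) \<Rightarrow> ('e \<Rightarrow> 'e)" where
  "op_mult f g = g \<circ> f"

inductive_set enveloping_algebra ::
    "('f::field \<Rightarrow> 'e::ab_group_add \<Rightarrow> 'e) \<Rightarrow> ('e \<Rightarrow> 'e \<Rightarrow> 'e) \<Rightarrow> ('e \<Rightarrow> 'e) set"
  for smul :: "'f::field \<Rightarrow> 'e::ab_group_add \<Rightarrow> 'e" and mul :: "'e \<Rightarrow> 'e \<Rightarrow> 'e" where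
  right_mult_in: "right_mult mul x \<in> enveloping_algebra smul mul"
| add_in: "f \<in> enveloping_algebra smul mul \<Longrightarrow> g \<in> enveloping_algebra smul mul
    \<Longrightarrow> f + g \<in> enveloping_algebra smul mul"
| scale_in: "f \<in> enveloping_algebra smul mul
    \<Longrightarrow> op_scale smul c f \<in> enveloping_algebra smul mul"
| mult_in: "f \<in> enveloping_algebra smul mul \<Longrightarrow> g \<in> enveloping_algebra smul mul
    \<Longrightarrow> op_mult f g \<in> enveloping_algebra smul mul"

section \<open>Isomorphism of algebras\<close>

text \<open>Each algebra is given by a carrier set, closed under the operations, a scalar multiplication
  and a product; its addition is that of the ambient type.\<close>

definition algebras_isomorphic ::
    "'a::ab_group_add set \<Rightarrow> ('f \<Rightarrow> 'a \<Rightarrow> 'a) \<Rightarrow> ('a \<Rightarrow> 'a \<Rightarrow> 'a) \<Rightarrow>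
     'b::ab_group_add set \<Rightarrow> ('f \<Rightarrow> 'b \<Rightarrow> 'b) \<Rightarrow> ('b \<Rightarrow> 'b \<Rightarrow> 'b) \<Rightarrow> bool" where
  "algebras_isomorphic S smulS multS T smulT multT \<longleftrightarrow>
    (\<exists>\<phi>. bij_betw \<phi> S T \<and>
      (\<forall>u\<in>S. \<forall>v\<in>S. \<phi> (u + v) = \<phi> u + \<phi> v) \<and>
      (\<forall>c. \<forall>u\<in>S. \<phi> (smulS c u) = smulT c (\<phi> u)) \<and>
      (\<forall>u\<in>S. \<forall>v\<in>S. \<phi> (multS u v) = multT (\<phi> u) (\<phi> v)))"

section \<open>Sanity checks\<close>

lemma (in vector_space) vector_space_op_scale: "vector_space (op_scale scale)"
  by unfold_locales
    (auto simp: op_scale_def fun_eq_iff scale_right_distrib scale_left_distrib)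

lemma (in nonassoc_algebra) subspace_enveloping_algebra:
  "module.subspace (op_scale smul) (enveloping_algebra smul mul)"
proof -
  interpret ops: vector_space "op_scale smul"
    by (rule vector_space_op_scale)
  have "op_scale smul 0 (right_mult mul 0) \<in> enveloping_algebra smul mul"
    by (intro scale_in right_mult_in)
  then show ?thesis
    by (auto intro!: ops.subspaceI add_in scale_in)
qed

lemma (in evolution_algebra) right_mult_product:
  "op_mult (right_mult mul (e i)) (right_mult mul (e j)) (e l) =
    (if l = i then smul (A $ i $ j) (\<Sum>k\<in>UNIV. smul (A $ j $ k) (e k)) else 0)"
proof -
  interpret L: Vector_Spaces.linear smul smul "\<lambda>y. mul y (e j)"
    by (rule linear_mult_left)
  have table: "mul (e k) (e j) = (if k = j then \<Sum>m\<in>UNIV. smul (A $ j $ m) (e m) else 0)" for k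
    by (simp add: mult_same mult_distinct)
  have "mul (\<Sum>k\<in>UNIV. smul (A $ i $ k) (e k)) (e j) =
      (\<Sum>k\<in>UNIV. smul (A $ i $ k) (mul (e k) (e j)))"
    by (simp add: L.sum L.scale)
  also have "\<dots> = (\<Sum>k\<in>UNIV. if k = j
      then smul (A $ i $ j) (\<Sum>m\<in>UNIV. smul (A $ j $ m) (e m)) else 0)"
    by (intro sum.cong) (auto simp: table)
  finally show ?thesis
    by (auto simp: op_mult_def right_mult_def mult_same mult_distinct L.zero)
qed

lemma algebra_M1_vec:
  "algebra_M1 ((*s) :: 'f::field \<Rightarrow> 'f^'n::finite \<Rightarrow> 'f^'n) (*) (\<lambda>i. axis i 1)"
proof unfold_locales
  show "inj (\<lambda>i. axis i 1 :: 'f^'n)"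
    by (auto simp: inj_on_def axis_eq_axis)
  have range: "range (\<lambda>i. axis i 1 :: 'f^'n) = cart_basis"
    by (auto simp: cart_basis_def)
  show "\<not> vec.dependent (range (\<lambda>i. axis i 1 :: 'f^'n))"
    unfolding range by (rule vec.independent_Basis)
  show "vec.span (range (\<lambda>i. axis i 1 :: 'f^'n)) = UNIV"
    unfolding range by (rule vec.span_Basis)
qed (auto simp: vec_eq_iff axis_def algebra_simps)

end

theory Submission
  imports Defs
begin

text \<open>
  Write \<open>R i\<close> for right multiplication by \<open>e i\<close>.  As a matrix it has a single nonzero row, the
  \<open>i\<close>-th, equal to the \<open>i\<close>-th row of \<open>A\<close>.  If no row of \<open>A\<close> vanishes, these matrices are linearly
  independent, so the assumption that the enveloping algebra has dimension \<open>n\<close> leaves no room for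
  anything else: it is the linear span of the \<open>R i\<close>
  (\<open>enveloping_algebra_subset_span_basis_op\<close>).

  But that span has to be closed under products.  The product of \<open>R i\<close> and \<open>R j\<close> has its only
  possibly nonzero row in position \<open>i\<close>, where it is \<open>A $ i $ j\<close> times the \<open>j\<close>-th row of \<open>A\<close>; lying in
  the span, it must be a multiple of \<open>R i\<close>, so this row is a multiple of the \<open>i\<close>-th row of \<open>A\<close>.  As
  the rows of \<open>A\<close> are linearly independent, \<open>A $ i $ j = 0\<close> whenever \<open>i \<noteq> j\<close>
  (\<open>structure_matrix_diagonal\<close>).  Hence \<open>A\<close> is diagonal with nonzero diagonal entries, each \<open>R i\<close>
  is a nonzero multiple of a diagonal matrix unit, and the enveloping algebra is the algebra of all
  diagonal operators.  Sending such an operator to the combination of the \<open>x i\<close> whose coefficients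
  are its eigenvalues is the required isomorphism.
\<close>

section \<open>Linear algebra\<close>

text \<open>Here \<open>dim\<close> is \<open>0\<close> on infinite-dimensional spaces, so a nonzero value guarantees that \<open>V\<close> has
  a finite basis and that the exchange lemma applies.\<close>

lemma (in vector_space) subset_span_if_card_eq_dim:
  assumes "independent B" "B \<subseteq> V" "finite B" "card B = dim V" "dim V \<noteq> 0"
  shows "V \<subseteq> span B"
proof
  fix v assume "v \<in> V"
  obtain C where C: "V \<subseteq> span C" "card C = dim V"
    using basis_exists[of V] by blast
  have fin: "finite C"
    using C(2) assms(5) card.infinite by fastforce
  show "v \<in> span B"
  proof (rule ccontr)
    assume v: "v \<notin> span B"
    then have "independent (insert v B)"
      using assms(1) by (rule independent_insertI)
    moreover have "insert v B \<subseteq> span C"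
      using \<open>v \<in> V\<close> assms(2) C(1) by blast
    ultimately have "card (insert v B) \<le> card C"
      using independent_span_bound[OF fin] by blast
    moreover have "v \<notin> B"
      using v span_base by blast
    ultimately show False
      using assms(3,4) C(2) by simp
  qed
qed

lemma full_rank_rows_independent:
  fixes A :: "'f::field^'n^'n"
  assumes "rank A = CARD('n)" and "(\<Sum>i\<in>UNIV. c i *s row i A) = 0"
  shows "c i = 0"
proof -
  have "vec.span (rows A) = UNIV"
    using assms(1) vec.dim_eq_full[of "rows A"] vec_dim_card[where 'a='f and 'n='n]
    by (simp add: row_rank_def_gen vec.dimension_def)
  then have "\<exists>B. A ** B = mat 1"
    by (metis matrix_left_invertible_span_rows_gen matrix_left_right_inverse)
  then show ?thesis
    using assms(2) by (simp add: matrix_right_invertible_independent_rows)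
qed

section \<open>Coordinates in an algebra with a basis\<close>

context algebra_with_basis
begin

definition coord :: "'e \<Rightarrow> 'n \<Rightarrow> 'f" where
  "coord v i = representation (range e) v (e i)"

lemma sum_coord: "(\<Sum>i\<in>UNIV. smul (coord v i) (e i)) = v"
proof -
  have "(\<Sum>b\<in>range e. smul (representation (range e) v b) b) = v"
    by (rule sum_representation_eq) (auto simp: independent_basis span_basis)
  then show ?thesis
    by (simp add: sum.reindex[OF inj_basis] coord_def)
qed

lemma coord_add: "coord (v + w) i = coord v i + coord w i"
  by (simp add: coord_def representation_add independent_basis span_basis)

lemma coord_scale: "coord (smul c v) i = c * coord v i"
  by (simp add: coord_def representation_scale independent_basis span_basis)

lemma coord_basis: "coord (e j) i = (if i = j then 1 else 0)"
  by (auto simp: coord_def representation_basis independent_basis inj_eq[OF inj_basis])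

lemma coord_zero: "coord 0 i = 0"
  using coord_scale[of 0 0 i] by simp

lemma coord_sum: "coord (\<Sum>j\<in>S. v j) i = (\<Sum>j\<in>S. coord (v j) i)"
  by (induction S rule: infinite_finite_induct) (auto simp: coord_add coord_zero)

lemma coord_combination: "coord (\<Sum>j\<in>UNIV. smul (c j) (e j)) i = c i"
  by (simp add: coord_sum coord_scale coord_basis if_distrib[of "(*) _"] cong: if_cong)

lemma coord_eqI: "(\<And>i. coord v i = coord w i) \<Longrightarrow> v = w"
  by (metis (no_types, lifting) sum.cong sum_coord)

lemma linear_right_mult: "Vector_Spaces.linear smul smul (right_mult mul x)"
  using linear_mult_left by (simp add: right_mult_def)

lemma linear_enveloping_algebra:
  assumes "f \<in> enveloping_algebra smul mul"
  shows "Vector_Spaces.linear smul smul f"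
proof -
  interpret vs: vector_space_pair smul smul ..
  show ?thesis
    using assms
  proof induction
    case (add_in f g)
    then show ?case
      using vs.linear_compose_add by (simp add: plus_fun_def)
  next
    case (scale_in f c)
    then show ?case
      using vs.linear_compose_scale_right by (simp add: op_scale_def)
  next
    case (mult_in f g)
    then show ?case
      unfolding op_mult_def by (intro Vector_Spaces.linear_compose)
  qed (rule linear_right_mult)
qed

lemma linear_eq_if_eq_on_basis:
  assumes "Vector_Spaces.linear smul smul f" "Vector_Spaces.linear smul smul g"
    and "\<And>i. f (e i) = g (e i)"
  shows "f = g"
proof
  fix v
  interpret vs: vector_space_pair smul smul ..
  show "f v = g v"
    by (rule vs.linear_eq_on[OF assms(1,2), of v "range e"]) (auto simp: span_basis assms(3))
qed

end

lemma (in algebra_M1) mult_combination: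
  "mul (\<Sum>i\<in>UNIV. smul (c i) (x i)) (\<Sum>i\<in>UNIV. smul (d i) (x i))
    = (\<Sum>i\<in>UNIV. smul (c i * d i) (x i))"
proof -
  have mult_basis: "mul (\<Sum>i\<in>UNIV. smul (c i) (x i)) (x j) = smul (c j) (x j)" for j
  proof -
    interpret L: Vector_Spaces.linear smul smul "\<lambda>y. mul y (x j)"
      by (rule linear_mult_left)
    have "mul (x i) (x j) = (if i = j then x j else 0)" for i
      by (simp add: M1_same M1_distinct)
    then show ?thesis
      by (simp add: L.sum L.scale if_distrib[of "smul _"] cong: if_cong)
  qed
  interpret R: Vector_Spaces.linear smul smul "\<lambda>y. mul (\<Sum>i\<in>UNIV. smul (c i) (x i)) y"
    by (rule linear_mult_right)
  show ?thesis
    by (simp add: R.sum R.scale mult_basis mult.commute)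
qed

section \<open>The span of the basis operators\<close>

context evolution_algebra
begin

definition basis_op :: "'n \<Rightarrow> 'e \<Rightarrow> 'e" where
  "basis_op i = right_mult mul (e i)"

lemma basis_op_basis: "basis_op j (e i) = (if i = j then mul (e i) (e i) else 0)"
  by (simp add: basis_op_def right_mult_def mult_distinct)

lemma basis_op_in: "basis_op i \<in> enveloping_algebra smul mul"
  by (simp add: basis_op_def right_mult_in)

lemma coord_mult_same: "coord (mul (e i) (e i)) k = A $ i $ k"
  by (simp add: mult_same coord_combination)

sublocale ops: vector_space "op_scale smul"
  by (rule vector_space_op_scale)

text \<open>In matrix terms: the \<open>i\<close>-th row of an element of the span is a multiple of the \<open>i\<close>-th row
  of \<open>A\<close>.\<close>

lemma span_basis_op_basis:
  assumes "f \<in> ops.span (range basis_op)"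
  shows "\<exists>c. f (e i) = smul c (mul (e i) (e i))"
  using assms
proof (induction rule: ops.span_induct)
  case base
  show ?case
  proof (rule ops.subspaceI)
    show "0 \<in> {f. \<exists>c. f (e i) = smul c (mul (e i) (e i))}"
      by (auto intro: exI[of _ 0])
  qed (auto simp: op_scale_def simp flip: scale_left_distrib)
next
  case (step f)
  then obtain j where "f = basis_op j"
    by blast
  then show ?case
    by (auto simp: basis_op_basis intro: exI[of _ 0] exI[of _ 1])
qed

text \<open>Only \<open>basis_op i\<close> is nonzero at \<open>e i\<close>, so no other basis operators can combine to it.\<close>

lemma independent_basis_op:
  assumes "\<And>i. mul (e i) (e i) \<noteq> 0"
  shows "inj basis_op" and "ops.independent (range basis_op)"
proof -
  show "inj basis_op"
    by (rule injI) (metis assms basis_op_basis)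
  show "ops.independent (range basis_op)"
    unfolding ops.dependent_def
  proof safe
    fix i
    assume "basis_op i \<in> ops.span (range basis_op - {basis_op i})"
    then have "basis_op i (e i) = 0"
    proof (induction rule: ops.span_induct)
      case base
      show ?case
        by (rule ops.subspaceI) (auto simp: op_scale_def)
    next
      case (step f)
      then show ?case
        by (auto simp: basis_op_basis)
    qed
    then show False
      by (simp add: basis_op_basis assms)
  qed
qed

lemma enveloping_algebra_subset_span_basis_op:
  assumes "\<And>i. mul (e i) (e i) \<noteq> 0"
    and "ops.dim (enveloping_algebra smul mul) = CARD('n)"
  shows "enveloping_algebra smul mul \<subseteq> ops.span (range basis_op)"
  by (rule ops.subset_span_if_card_eq_dim)
    (auto simp: independent_basis_op assms basis_op_in card_image)

section \<open>Diagonality\<close>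

lemma structure_matrix_diagonal:
  assumes rank: "rank A = CARD('n)"
    and span: "enveloping_algebra smul mul \<subseteq> ops.span (range basis_op)"
    and "i \<noteq> j"
  shows "A $ i $ j = 0"
proof -
  have "op_mult (basis_op i) (basis_op j) \<in> ops.span (range basis_op)"
    using span by (auto intro: mult_in basis_op_in)
  then obtain c where "op_mult (basis_op i) (basis_op j) (e i) = smul c (mul (e i) (e i))"
    using span_basis_op_basis by blast
  then have "smul (A $ i $ j) (mul (e j) (e j)) = smul c (mul (e i) (e i))"
    by (simp add: basis_op_def right_mult_product mult_same)
  then have "coord (smul (A $ i $ j) (mul (e j) (e j))) k = coord (smul c (mul (e i) (e i))) k" for k
    by simp
  then have rows: "A $ i $ j * A $ j $ k = c * A $ i $ k" for k
    by (simp add: coord_scale coord_mult_same)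
  define d where "d l = (if l = j then A $ i $ j else if l = i then - c else 0)" for l
  have "(\<Sum>l\<in>UNIV. d l *s row l A) = (\<Sum>l\<in>{i, j}. d l *s row l A)"
    by (rule sum.mono_neutral_right) (auto simp: d_def)
  also have "\<dots> = 0"
    using \<open>i \<noteq> j\<close> by (simp add: d_def vec_eq_iff row_def rows)
  finally have "d j = 0"
    by (rule full_rank_rows_independent[OF rank])
  then show ?thesis
    by (simp add: d_def)
qed

definition eigenvalue :: "('e \<Rightarrow> 'e) \<Rightarrow> 'n \<Rightarrow> 'f" where
  "eigenvalue f i = coord (f (e i)) i"

text \<open>Once \<open>A\<close> is invertible and diagonal, the enveloping algebra consists of all the diagonal
  operators, and these multiply eigenvalue by eigenvalue.\<close>

lemma enveloping_algebra_isomorphic_M1_if_diagonal: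
  fixes smul1 :: "'f \<Rightarrow> 'm::ab_group_add \<Rightarrow> 'm" and x :: "'n \<Rightarrow> 'm"
  assumes M1: "algebra_M1 smul1 mul1 x"
    and span: "enveloping_algebra smul mul \<subseteq> ops.span (range basis_op)"
    and diag: "\<And>i j. i \<noteq> j \<Longrightarrow> A $ i $ j = 0"
    and nonzero: "\<And>i. A $ i $ i \<noteq> 0"
  shows "algebras_isomorphic (enveloping_algebra smul mul) (op_scale smul) op_mult
    UNIV smul1 mul1"
proof -
  interpret M1: algebra_M1 smul1 mul1 x
    by (rule M1)
  let ?M = "enveloping_algebra smul mul"
  define \<phi> where "\<phi> f = (\<Sum>i\<in>UNIV. smul1 (eigenvalue f i) (x i))" for f
  have square: "mul (e i) (e i) = smul (A $ i $ i) (e i)" for i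
    by (rule coord_eqI) (auto simp: coord_mult_same coord_scale coord_basis diag)
  have eigen: "f (e i) = smul (eigenvalue f i) (e i)" if f: "f \<in> ?M" for f i
  proof -
    obtain c where "f (e i) = smul c (mul (e i) (e i))"
      using span_basis_op_basis span f by blast
    then show ?thesis
      by (simp add: square eigenvalue_def coord_scale coord_basis)
  qed
  have "inj_on \<phi> ?M"
  proof (rule inj_onI)
    fix f g assume fg: "f \<in> ?M" "g \<in> ?M" "\<phi> f = \<phi> g"
    then have "eigenvalue f i = eigenvalue g i" for i
      by (metis M1.coord_combination \<phi>_def)
    then show "f = g"
      using fg by (intro linear_eq_if_eq_on_basis) (auto simp: linear_enveloping_algebra eigen)
  qed
  moreover have "m \<in> \<phi> ` ?M" for m
  proof
    \<comment> \<open>Since \<open>A\<close> is diagonal, \<open>basis_op i\<close> has the single nonzero eigenvalue \<open>A $ i $ i\<close>.\<close>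
    define v where "v = (\<Sum>i\<in>UNIV. smul (M1.coord m i / A $ i $ i) (e i))"
    interpret R: Vector_Spaces.linear smul smul "mul (e i)" for i
      by (rule linear_mult_right)
    have "mul (e i) (e j) = (if j = i then smul (A $ i $ i) (e i) else 0)" for i j
      by (simp add: square mult_distinct)
    then have "right_mult mul v (e i) = smul (M1.coord m i) (e i)" for i
      by (simp add: right_mult_def v_def R.sum R.scale if_distrib[of "smul _"] nonzero cong: if_cong)
    then have "eigenvalue (right_mult mul v) i = M1.coord m i" for i
      by (simp add: eigenvalue_def coord_scale coord_basis)
    then show "m = \<phi> (right_mult mul v)"
      by (simp add: \<phi>_def M1.sum_coord)
  qed (rule right_mult_in)
  ultimately have "bij_betw \<phi> ?M UNIV"
    by (auto simp: bij_betw_def)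
  moreover have "\<phi> (f + g) = \<phi> f + \<phi> g" for f g
    by (simp add: \<phi>_def eigenvalue_def coord_add M1.scale_left_distrib sum.distrib)
  moreover have "\<phi> (op_scale smul c f) = smul1 c (\<phi> f)" for c f
    by (simp add: \<phi>_def eigenvalue_def op_scale_def coord_scale M1.scale_sum_right)
  moreover have "\<phi> (op_mult f g) = mul1 (\<phi> f) (\<phi> g)" if "f \<in> ?M" "g \<in> ?M" for f g
  proof -
    interpret g: Vector_Spaces.linear smul smul g
      using that by (intro linear_enveloping_algebra)
    have "op_mult f g (e i) = smul (eigenvalue f i * eigenvalue g i) (e i)" for i
      using that by (simp add: op_mult_def eigen g.scale)
    then have "eigenvalue (op_mult f g) i = eigenvalue f i * eigenvalue g i" for i
      by (simp add: eigenvalue_def[of "op_mult f g"] coord_scale coord_basis)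
    then show ?thesis
      by (simp add: \<phi>_def M1.mult_combination)
  qed
  ultimately show ?thesis
    unfolding algebras_isomorphic_def by blast
qed

end

section \<open>Enveloping algebras of minimal dimension\<close>

theorem proposition4p3:
  fixes smul :: "'f::field_char_0 \<Rightarrow> 'e::ab_group_add \<Rightarrow> 'e"
    and mul :: "'e \<Rightarrow> 'e \<Rightarrow> 'e"
    and e :: "'n::finite \<Rightarrow> 'e"
    and A :: "'f^'n^'n"
    and smul1 :: "'f \<Rightarrow> 'm::ab_group_add \<Rightarrow> 'm"
    and mul1 :: "'m \<Rightarrow> 'm \<Rightarrow> 'm"
    and x :: "'n \<Rightarrow> 'm"
  assumes "evolution_algebra smul mul e A"
    and "vector_space.dim (op_scale smul) (enveloping_algebra smul mul) = CARD('n)"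
    and "rank A = CARD('n)"
    and "algebra_M1 smul1 mul1 x"
  shows "algebras_isomorphic
      (enveloping_algebra smul mul) (op_scale smul) op_mult
      (UNIV :: 'm set) smul1 mul1"
proof -
  interpret evolution_algebra smul mul e A
    by (rule assms(1))
  have row_nonzero: "row i A \<noteq> 0" for i
  proof
    assume "row i A = 0"
    then have "(\<Sum>j\<in>UNIV. (if j = i then 1 else 0) *s row j A) = 0"
      by (intro sum.neutral) auto
    from full_rank_rows_independent[OF assms(3) this, of i] show False
      by simp
  qed
  have "mul (e i) (e i) \<noteq> 0" for i
  proof
    assume "mul (e i) (e i) = 0"
    then have "row i A = 0"
      using coord_mult_same[of i] by (simp add: vec_eq_iff row_def coord_zero)
    with row_nonzero show False
      by blast
  qed
  then have span: "enveloping_algebra smul mul \<subseteq> ops.span (range basis_op)"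
    using assms(2) by (rule enveloping_algebra_subset_span_basis_op)
  have diag: "A $ i $ j = 0" if "i \<noteq> j" for i j
    using assms(3) span that by (rule structure_matrix_diagonal)
  have "A $ i $ i \<noteq> 0" for i
    using row_nonzero[of i] diag[of i] by (auto simp: vec_eq_iff row_def) metis
  with assms(4) span diag show ?thesis
    by (rule enveloping_algebra_isomorphic_M1_if_diagonal)
qed

end
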